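(* Let $X$ be a real Banach space with $\dim X\ge 2$. The following are equivalent. (i) $\mathrm{DR}_B(X)=1$. (ii) For every $u,v\in S_X$ with $u\perp_B v$ and every $s>0$, $\|su-v\|\ge\sqrt{s}\,\|u-v\|$. (iii) For every $u,v\in S_X$ with $u\perp_B v$, the function $\varphi_{u,v}(r)=\|e^{r}u-e^{-r}v\|$, $r\in\mathbb R$, has a global minimum at $r=0$. Furthermore, each of these conditions implies that $$u-v\perp_B u+v$$ for every $u,v\in S_X$ satisfying $u\perp_B v$.
   Context: $S_X$ is the unit sphere of $X$. Birkhoff orthogonality: $x\perp_B y$ iff $\|x+\lambda y\|\ge\|x\|$ for all $\lambda\in\mathbb R$. For nonzero $x,y\in X$ put $\alpha[x,y]=\left\|\frac{x}{\|x\|}-\frac{y}{\|y\|}\right\|$ and $\beta[x,y]=\left\|\frac{x}{\|y\|}-\frac{y}{\|x\|}\right\|$. The Birkhoff-orthogonal Dehghan--Rooin constant is $$\mathrm{DR}_B(X)=\sup\left\{\frac{\alpha[x,y]}{\beta[x,y]}: x,y\in X\setminus\{0\},\ x\perp_B y,\ \beta[x,y]\ne 0\right\}.$$ *)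

theory Defs
  imports "HOL-Analysis.Analysis"
begin

definition birkhoff_orth :: "'a::real_normed_vector \<Rightarrow> 'a \<Rightarrow> bool"  (infix "\<bottom>\<^sub>B" 50)
  where "x \<bottom>\<^sub>B y \<longleftrightarrow> (\<forall>l::real. norm (x + l *\<^sub>R y) \<ge> norm x)"

text \<open>The two distances below are only meaningful for nonzero arguments.\<close>

definition alpha_dist :: "'a::real_normed_vector \<Rightarrow> 'a \<Rightarrow> real"
  where "alpha_dist x y = norm (x /\<^sub>R norm x - y /\<^sub>R norm y)"

definition beta_dist :: "'a::real_normed_vector \<Rightarrow> 'a \<Rightarrow> real"
  where "beta_dist x y = norm (x /\<^sub>R norm y - y /\<^sub>R norm x)"

definition DR_B_ratios :: "'a::real_normed_vector itself \<Rightarrow> real set"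
  where "DR_B_ratios _ = {alpha_dist x y / beta_dist x y | x y :: 'a.
           x \<noteq> 0 \<and> y \<noteq> 0 \<and> x \<bottom>\<^sub>B y \<and> beta_dist x y \<noteq> 0}"

text \<open>
  The supremum is taken in the reals. It is a genuine supremum in dimension at least two: see
  the lemmas on boundedness and non-emptiness at the end of this theory.
\<close>

definition DR_B :: "'a::real_normed_vector itself \<Rightarrow> real"
  where "DR_B X = Sup (DR_B_ratios X)"

definition phi :: "'a::real_normed_vector \<Rightarrow> 'a \<Rightarrow> real \<Rightarrow> real"
  where "phi u v r = norm (exp r *\<^sub>R u - exp (- r) *\<^sub>R v)"

text \<open>
  The library function dim returns 0 on infinite-dimensional spaces, so dimension at least two
  is expressed by the existence of two linearly independent vectors.
\<close>

definition dim_ge_2 :: "'a::real_vector itself \<Rightarrow> bool"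
  where "dim_ge_2 _ \<longleftrightarrow> (\<exists>B :: 'a set. independent B \<and> card B = 2)"

lemma beta_dist_lower:
  fixes x y :: "'a::real_normed_vector"
  assumes "x \<noteq> 0" "y \<noteq> 0" "x \<bottom>\<^sub>B y"
  shows "beta_dist x y \<ge> 1 / 2"
proof -
  define s where "s = norm x / norm y"
  have s: "s > 0" using assms by (simp add: s_def)
  have "norm x \<le> norm (x + (- norm y / norm x) *\<^sub>R y)"
    using assms(3) unfolding birkhoff_orth_def by blast
  also have "x + (- norm y / norm x) *\<^sub>R y = norm y *\<^sub>R (x /\<^sub>R norm y - y /\<^sub>R norm x)"
    using assms by (simp add: algebra_simps divide_inverse)
  finally have "norm x \<le> norm y * beta_dist x y"
    by (simp add: beta_dist_def)
  hence b1: "s \<le> beta_dist x y"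
    using assms by (simp add: s_def field_simps)
  have "norm (y /\<^sub>R norm x) - norm (x /\<^sub>R norm y) \<le> beta_dist x y"
    unfolding beta_dist_def by (metis norm_minus_commute norm_triangle_ineq2)
  hence b2: "1 / s - s \<le> beta_dist x y"
    by (simp add: s_def divide_inverse mult.commute)
  show ?thesis
  proof (cases "s \<ge> 1 / 2")
    case True
    with b1 show ?thesis by linarith
  next
    case False
    with s have "1 / s \<ge> 2" by (simp add: field_simps)
    with False b2 show ?thesis by linarith
  qed
qed

lemma bdd_above_DR_B_ratios:
  "bdd_above (DR_B_ratios TYPE('a::real_normed_vector))"
proof (rule bdd_aboveI[where M = 4])
  fix t assume "t \<in> DR_B_ratios TYPE('a)"
  then obtain x y :: 'a where t: "t = alpha_dist x y / beta_dist x y"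
    and xy: "x \<noteq> 0" "y \<noteq> 0" "x \<bottom>\<^sub>B y"
    by (auto simp: DR_B_ratios_def)
  have "alpha_dist x y \<le> norm (x /\<^sub>R norm x) + norm (y /\<^sub>R norm y)"
    unfolding alpha_dist_def by (rule norm_triangle_ineq4)
  also have "\<dots> = 2" using xy by simp
  finally show "t \<le> 4"
    using beta_dist_lower[OF xy] by (simp add: t field_simps)
qed

lemma DR_B_ratios_nonempty:
  assumes "dim_ge_2 TYPE('a::real_normed_vector)"
  shows "DR_B_ratios TYPE('a) \<noteq> {}"
proof -
  obtain B :: "'a set" where B: "independent B" "card B = 2"
    using assms by (auto simp: dim_ge_2_def)
  then obtain x y where "B = {x, y}" "x \<noteq> y" by (auto simp: card_2_iff)
  with B have ind: "independent {x, y}" "x \<noteq> y" by auto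
  have y0: "y \<noteq> 0" using ind(1) dependent_zero by blast
  have x_sp: "x \<notin> span {y}"
    using ind by (auto simp: independent_insert)
  define f where "f k = norm (x - k *\<^sub>R y)" for k :: real
  define R where "R = 2 * norm x / norm y"
  have R: "R \<ge> 0" by (simp add: R_def)
  have "continuous_on {- R..R} f"
    unfolding f_def by (intro continuous_intros)
  then obtain l where l_min: "\<And>k. k \<in> {- R..R} \<Longrightarrow> f l \<le> f k"
    using continuous_attains_inf[of "{- R..R}" f] R
    by (metis atLeastatMost_empty_iff compact_Icc neg_le_0_iff_le order_trans)
  have l: "f l \<le> f k" for k
  proof (cases "k \<in> {- R..R}")
    case False
    hence "R \<le> \<bar>k\<bar>" by auto
    hence "2 * norm x \<le> norm (k *\<^sub>R y)"
      using y0 by (simp add: R_def field_simps)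
    moreover have "norm (k *\<^sub>R y) \<le> norm x + f k"
      unfolding f_def by (metis norm_minus_commute norm_triangle_sub)
    moreover have "f l \<le> norm x"
      using l_min[of 0] R by (simp add: f_def)
    ultimately show ?thesis by linarith
  qed (rule l_min)
  define z where "z = x - l *\<^sub>R y"
  have z0: "z \<noteq> 0"
    using x_sp unfolding z_def by (auto simp: span_singleton)
  have orth: "z \<bottom>\<^sub>B y"
    unfolding birkhoff_orth_def
  proof
    fix k :: real
    show "norm z \<le> norm (z + k *\<^sub>R y)"
      using l[of "l - k"] by (simp add: z_def f_def algebra_simps)
  qed
  have "beta_dist z y \<noteq> 0" using beta_dist_lower[OF z0 y0 orth] by linarith
  thus ?thesis using z0 y0 orth by (auto simp: DR_B_ratios_def)
qed

end

theory Submission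
  imports Defs
begin

text \<open>
  For \<open>x = a u\<close> and \<open>y = b v\<close> with unit vectors \<open>u\<close>, \<open>v\<close> and \<open>a, b > 0\<close>, the two distances are
  \<open>\<phi>(0)\<close> and \<open>\<phi>(ln (a/b))\<close>, so every ratio is at most 1 iff \<open>\<phi>\<close> is minimal at 0, and the
  ratio 1 is always attained at \<open>a = b\<close>. Substituting \<open>s = e\<^bsup>2r\<^esup>\<close> turns minimality of \<open>\<phi>\<close> into (ii).
  With \<open>s = (1 + t) / (1 - t)\<close>, condition (ii) reads
  \<open>\<parallel>(u - v) + t (u + v)\<parallel> \<ge> sqrt (1 - t\<^sup>2) \<parallel>u - v\<parallel>\<close>; the loss is of second order in \<open>t\<close>,
  so by convexity of the norm 0 is a global minimum of the left-hand side.
\<close>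

lemma birkhoff_orth_scaleR:
  assumes "x \<bottom>\<^sub>B y"
  shows "(a *\<^sub>R x) \<bottom>\<^sub>B (b *\<^sub>R y)"
proof (cases "a = 0")
  case False
  show ?thesis
    unfolding birkhoff_orth_def
  proof
    fix l :: real
    have "a *\<^sub>R x + l *\<^sub>R b *\<^sub>R y = a *\<^sub>R (x + (l * b / a) *\<^sub>R y)"
      using False by (simp add: algebra_simps)
    moreover have "norm x \<le> norm (x + (l * b / a) *\<^sub>R y)"
      using assms unfolding birkhoff_orth_def by blast
    ultimately show "norm (a *\<^sub>R x) \<le> norm (a *\<^sub>R x + l *\<^sub>R b *\<^sub>R y)"
      by (simp add: mult_left_mono)
  qed
qed (simp add: birkhoff_orth_def)

lemma birkhoff_orth_sgn:
  assumes "x \<bottom>\<^sub>B y"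
  shows "sgn x \<bottom>\<^sub>B sgn y"
  using birkhoff_orth_scaleR[OF assms] by (simp add: sgn_div_norm)

lemma alpha_dist_eq_phi: "alpha_dist x y = phi (sgn x) (sgn y) 0"
  by (simp add: alpha_dist_def phi_def sgn_div_norm)

text \<open>Since \<open>x = norm x *\<^sub>R sgn x\<close>, the coefficients of
  \<open>sgn x\<close> and \<open>sgn y\<close> in \<open>beta_dist\<close> are
  \<open>norm x / norm y\<close> and its reciprocal, hence \<open>exp r\<close> and
  \<open>exp (- r)\<close> with r the logarithm of that ratio.\<close>

lemma beta_dist_eq_phi:
  assumes "x \<noteq> 0" "y \<noteq> 0"
  shows "beta_dist x y = phi (sgn x) (sgn y) (ln (norm x / norm y))"
  using assms by (simp add: beta_dist_def phi_def sgn_div_norm exp_minus field_simps)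

text \<open>Pulling out \<open>exp (- r)\<close> leaves coefficient 1 on \<open>v\<close>, the shape
  of condition (ii) with \<open>s = exp (2 * r)\<close>.\<close>

lemma phi_eq: "phi u v r = exp (- r) * norm (exp (2 * r) *\<^sub>R u - v)"
proof -
  have "exp r *\<^sub>R u - exp (- r) *\<^sub>R v = exp (- r) *\<^sub>R (exp (2 * r) *\<^sub>R u - v)"
    by (simp add: scaleR_diff_right flip: exp_add)
  thus ?thesis by (simp add: phi_def)
qed

lemma phi_minimal_iff:
  "(\<forall>r. phi u v 0 \<le> phi u v r) \<longleftrightarrow> (\<forall>s>0. sqrt s * norm (u - v) \<le> norm (s *\<^sub>R u - v))"
proof -
  have "phi u v 0 \<le> phi u v r \<longleftrightarrow>
      sqrt (exp (2 * r)) * norm (u - v) \<le> norm (exp (2 * r) *\<^sub>R u - v)" for r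
  proof -
    have "sqrt (exp (2 * r)) = exp r"
      by (simp add: real_sqrt_unique exp_double)
    thus ?thesis
      by (simp add: phi_eq[of u v r] phi_def[of u v 0] exp_minus field_simps)
  qed
  moreover have "(\<forall>s>0. P s) \<longleftrightarrow> (\<forall>r. P (exp (2 * r)))" for P :: "real \<Rightarrow> bool"
  proof
    assume "\<forall>r. P (exp (2 * r))"
    show "\<forall>s>0. P s"
    proof (intro allI impI)
      fix s :: real assume "s > 0"
      thus "P s" using \<open>\<forall>r. P (exp (2 * r))\<close>[rule_format, of "ln s / 2"] by simp
    qed
  qed simp
  ultimately show ?thesis by presburger
qed

lemma DR_B_eq_1_iff:
  assumes "dim_ge_2 TYPE('a::real_normed_vector)"
  shows "DR_B TYPE('a) = 1 \<longleftrightarrow> (\<forall>u \<in> sphere (0::'a) 1. \<forall>v \<in> sphere 0 1. u \<bottom>\<^sub>B v \<longrightarrow>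
    (\<forall>r. phi u v 0 \<le> phi u v r))"
proof
  assume DR: "DR_B TYPE('a) = 1"
  show "\<forall>u \<in> sphere (0::'a) 1. \<forall>v \<in> sphere 0 1. u \<bottom>\<^sub>B v \<longrightarrow> (\<forall>r. phi u v 0 \<le> phi u v r)"
  proof (intro ballI impI allI)
    fix u v :: 'a and r :: real
    assume u: "u \<in> sphere 0 1" and v: "v \<in> sphere 0 1" and uv: "u \<bottom>\<^sub>B v"
    \<comment> \<open>Stretching \<open>u\<close> makes the norm ratio of \<open>x\<close> and
      \<open>v\<close> equal to \<open>exp r\<close>, so that \<open>beta_dist x v\<close> is
      \<open>phi u v r\<close> while \<open>alpha_dist x v\<close> stays
      \<open>phi u v 0\<close>.\<close>
    define x where "x = exp r *\<^sub>R u"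
    have nz: "x \<noteq> 0" "v \<noteq> 0" using u v by (auto simp: x_def)
    have orth: "x \<bottom>\<^sub>B v"
      using birkhoff_orth_scaleR[OF uv, of "exp r" 1] by (simp add: x_def)
    have pos: "beta_dist x v > 0"
      using beta_dist_lower[OF nz orth] by simp
    have "alpha_dist x v / beta_dist x v \<in> DR_B_ratios TYPE('a)"
      using nz orth pos unfolding DR_B_ratios_def by force
    hence "alpha_dist x v / beta_dist x v \<le> 1"
      using cSup_upper bdd_above_DR_B_ratios DR unfolding DR_B_def by metis
    hence "alpha_dist x v \<le> beta_dist x v"
      using pos by simp
    moreover have "sgn x = u" "sgn v = v" "ln (norm x / norm v) = r"
      using u v by (simp_all add: x_def sgn_div_norm)
    ultimately show "phi u v 0 \<le> phi u v r"
      by (simp add: alpha_dist_eq_phi beta_dist_eq_phi nz)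
  qed
next
  assume min: "\<forall>u \<in> sphere (0::'a) 1. \<forall>v \<in> sphere 0 1. u \<bottom>\<^sub>B v \<longrightarrow>
    (\<forall>r. phi u v 0 \<le> phi u v r)"
  have "t \<le> 1" if "t \<in> DR_B_ratios TYPE('a)" for t
  proof -
    obtain x y :: 'a where t: "t = alpha_dist x y / beta_dist x y"
      and xy: "x \<noteq> 0" "y \<noteq> 0" "x \<bottom>\<^sub>B y"
      using \<open>t \<in> DR_B_ratios TYPE('a)\<close> by (auto simp: DR_B_ratios_def)
    have "sgn x \<in> sphere 0 1" "sgn y \<in> sphere 0 1"
      using xy by (simp_all add: norm_sgn)
    hence "alpha_dist x y \<le> beta_dist x y"
      using min birkhoff_orth_sgn[OF xy(3)] xy by (simp add: alpha_dist_eq_phi beta_dist_eq_phi)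
    thus ?thesis
      using beta_dist_lower[OF xy] by (simp add: t)
  qed
  \<comment> \<open>Normalizing any admissible pair makes both distances coincide; that such a pair
    exists is where the dimension enters.\<close>
  moreover have "1 \<in> DR_B_ratios TYPE('a)"
  proof -
    obtain x y :: 'a where xy: "x \<noteq> 0" "y \<noteq> 0" "x \<bottom>\<^sub>B y"
      using DR_B_ratios_nonempty[OF assms] by (auto simp: DR_B_ratios_def)
    have nz: "sgn x \<noteq> 0" "sgn y \<noteq> 0" using xy by (simp_all add: sgn_zero_iff)
    have orth: "sgn x \<bottom>\<^sub>B sgn y" by (rule birkhoff_orth_sgn[OF xy(3)])
    have pos: "beta_dist (sgn x) (sgn y) > 0"
      using beta_dist_lower[OF nz orth] by simp
    have "alpha_dist (sgn x) (sgn y) = beta_dist (sgn x) (sgn y)"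
      using xy by (simp add: alpha_dist_def beta_dist_def norm_sgn)
    hence "alpha_dist (sgn x) (sgn y) / beta_dist (sgn x) (sgn y) = 1"
      using pos by simp
    thus ?thesis
      using nz orth pos unfolding DR_B_ratios_def by force
  qed
  ultimately show "DR_B TYPE('a) = 1"
    unfolding DR_B_def by (intro cSup_eq_maximum)
qed

text \<open>If the norm dropped by d > 0 from \<open>w\<close> to \<open>w + l *\<^sub>R z\<close>,
  convexity would force a drop of at least t d at the fraction t of that segment, whereas the
  hypothesis allows at most t^2 c with \<open>c = l\<^sup>2 * norm w\<close>. For small t this is
  impossible.\<close>

lemma birkhoff_orth_if_quadratic_loss:
  assumes loss: "\<And>t. \<bar>t\<bar> < 1 \<Longrightarrow> (1 - t\<^sup>2) * norm w \<le> norm (w + t *\<^sub>R z)"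
  shows "w \<bottom>\<^sub>B z"
  unfolding birkhoff_orth_def
proof (intro allI, rule ccontr)
  fix l :: real
  define d where "d = norm w - norm (w + l *\<^sub>R z)"
  assume "\<not> norm w \<le> norm (w + l *\<^sub>R z)"
  hence d: "d > 0" by (simp add: d_def)
  define c where "c = l\<^sup>2 * norm w"
  have c: "c \<ge> 0" by (simp add: c_def)
  have "0 < 1 + \<bar>l\<bar>" by linarith
  \<comment> \<open>The third bound makes the hypothesis applicable at \<open>t * l\<close>, the
    fourth gives \<open>t * c < d\<close>; adding 1 keeps the denominators positive.\<close>
  then obtain t where t: "0 < t" "t < 1" "t < 1 / (1 + \<bar>l\<bar>)" "t < d / (1 + c)"
    using dense[of 0 "min 1 (min (1 / (1 + \<bar>l\<bar>)) (d / (1 + c)))"] d c by auto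
  have tl: "\<bar>t * l\<bar> < 1"
    using t(1,3) by (simp add: abs_mult field_simps)
  have tc: "t * c < d"
    using t(1,4) c by (simp add: field_simps)
  have "w + (t * l) *\<^sub>R z = (1 - t) *\<^sub>R w + t *\<^sub>R (w + l *\<^sub>R z)"
    by (simp add: algebra_simps)
  hence "norm (w + (t * l) *\<^sub>R z) \<le> (1 - t) * norm w + t * norm (w + l *\<^sub>R z)"
    using norm_triangle_ineq[of "(1 - t) *\<^sub>R w" "t *\<^sub>R (w + l *\<^sub>R z)"] t by simp
  also have "\<dots> = norm w - t * d"
    by (simp add: d_def algebra_simps)
  finally have "(1 - (t * l)\<^sup>2) * norm w \<le> norm w - t * d"
    using loss[OF tl] by simp
  hence "t * d \<le> t * (t * c)"
    by (simp add: c_def algebra_simps power2_eq_square)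
  thus False using t(1) tc by simp
qed

lemma birkhoff_orth_diagonals:
  assumes le: "\<forall>s>0. sqrt s * norm (u - v) \<le> norm (s *\<^sub>R u - v)"
  shows "(u - v) \<bottom>\<^sub>B (u + v)"
proof (rule birkhoff_orth_if_quadratic_loss)
  fix t :: real assume t: "\<bar>t\<bar> < 1"
  define s where "s = (1 + t) / (1 - t)"
  have s: "s > 0" using t by (simp add: s_def)
  have t2: "t\<^sup>2 \<le> 1" using t by (simp add: abs_square_le_1)
  have "(1 - t) * sqrt s = sqrt ((1 - t)\<^sup>2 * s)"
    using t by (simp add: real_sqrt_mult)
  also have "(1 - t)\<^sup>2 * s = 1 - t\<^sup>2"
    using t by (simp add: s_def field_simps power2_eq_square)
  finally have "(1 - t) * sqrt s = sqrt (1 - t\<^sup>2)" .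
  \<comment> \<open>A number in [0,1] is at most its square root; this weakens the factor from (ii)
    to the quadratic loss.\<close>
  moreover have "1 - t\<^sup>2 \<le> sqrt (1 - t\<^sup>2)"
    using t2 by (intro real_le_rsqrt) (simp add: power2_eq_square mult_left_le)
  ultimately have "(1 - t\<^sup>2) * norm (u - v) \<le> (1 - t) * (sqrt s * norm (u - v))"
    by (metis mult.assoc mult_right_mono norm_ge_zero)
  also have "\<dots> \<le> (1 - t) * norm (s *\<^sub>R u - v)"
    using le s t by (intro mult_left_mono) auto
  also have "\<dots> = norm ((1 - t) *\<^sub>R (s *\<^sub>R u - v))"
    using t by simp
  also have "(1 - t) *\<^sub>R (s *\<^sub>R u - v) = ((1 - t) * s) *\<^sub>R u - (1 - t) *\<^sub>R v"
    by (simp add: scaleR_diff_right)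
  also have "(1 - t) * s = 1 + t"
    using t by (simp add: s_def)
  also have "(1 + t) *\<^sub>R u - (1 - t) *\<^sub>R v = (u - v) + t *\<^sub>R (u + v)"
    by (simp add: algebra_simps)
  finally show "(1 - t\<^sup>2) * norm (u - v) \<le> norm ((u - v) + t *\<^sub>R (u + v))" .
qed

theorem theorem2p10:
  assumes "dim_ge_2 TYPE('a::banach)"
  shows
    "let cond_i = (DR_B TYPE('a) = 1);
         cond_ii = (\<forall>u \<in> sphere (0::'a) 1. \<forall>v \<in> sphere 0 1. u \<bottom>\<^sub>B v \<longrightarrow>
           (\<forall>s::real. s > 0 \<longrightarrow> norm (s *\<^sub>R u - v) \<ge> sqrt s * norm (u - v)));
         cond_iii = (\<forall>u \<in> sphere (0::'a) 1. \<forall>v \<in> sphere 0 1. u \<bottom>\<^sub>B v \<longrightarrow>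
           (\<forall>r::real. phi u v r \<ge> phi u v 0));
         diag = (\<forall>u \<in> sphere (0::'a) 1. \<forall>v \<in> sphere 0 1. u \<bottom>\<^sub>B v \<longrightarrow>
           (u - v) \<bottom>\<^sub>B (u + v))
     in (cond_i \<longleftrightarrow> cond_ii) \<and> (cond_ii \<longleftrightarrow> cond_iii) \<and>
        (cond_i \<longrightarrow> diag) \<and> (cond_ii \<longrightarrow> diag) \<and> (cond_iii \<longrightarrow> diag)"
  \<comment> \<open>The rewriting turns (i) and (iii) literally into (ii), so only the implication
    from (ii) to the diagonals remains.\<close>
  unfolding Let_def DR_B_eq_1_iff[OF assms] phi_minimal_iff
  using birkhoff_orth_diagonals by blast

end
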